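(* Let $(X,\mathcal{T})$ be an arbitrary topological space and let $\mathcal{A}$ be a finite family of mutually disjoint, non-empty subsets of $X$. Then $\mathcal{T}_{\mathcal{A}}:=(\mathcal{A}\,\bar{\cap}\,\mathcal{T})^*$ is a topology on $\langle\mathcal{A}\rangle$. Moreover: (i) if $\mathcal{T}$ is a $T_0$ topology, then so is $\mathcal{T}_{\mathcal{A}}$; (ii) for every $A\in\mathcal{A}$, the topology induced on $A$ by $\mathcal{T}$ coincides with the topology induced on $A$ by $\mathcal{T}_{\mathcal{A}}$; (iii) the family $\mathcal{A}$ is $\mathcal{T}_{\mathcal{A}}$-disconnected; (iv) if additionally $\langle\mathcal{A}\rangle=X$ and each set in $\mathcal{A}$ is $\mathcal{T}$-connected, then the connected components with respect to $\mathcal{T}_{\mathcal{A}}$ coincide with the sets in $\mathcal{A}$.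
   Context: For a family $\mathcal{A}$ of subsets of $X$: $\langle\mathcal{A}\rangle:=\bigcup\mathcal{A}$ is the union of all sets in $\mathcal{A}$, and $\mathcal{A}^*:=\{\bigcup\mathcal{A}' : \mathcal{A}'\subseteq\mathcal{A}\}$. For two families $\mathcal{A},\mathcal{B}$ of subsets of $X$, $\mathcal{A}\,\bar{\cap}\,\mathcal{B}:=\{A\cap B : A\in\mathcal{A},\,B\in\mathcal{B}\}$. If $\mathcal{A}$ is a finite family of mutually disjoint non-empty sets and $\mathcal{S}$ is a topology on $\bigcup\mathcal{A}$, then $\mathcal{A}$ is called $\mathcal{S}$-disconnected if each set $A\in\mathcal{A}$ is open in $\mathcal{S}$. A topology is $T_0$ if for any two distinct points there is an open set containing precisely one of them. A subset is $\mathcal{T}$-connected if it is connected in the topology induced from $\mathcal{T}$. *)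

theory Defs
  imports "HOL-Analysis.Analysis"
begin

definition union_closure :: "'a set set \<Rightarrow> 'a set set" where
  "union_closure \<A> = {\<Union>\<A>' | \<A>'. \<A>' \<subseteq> \<A>}"

definition pairwise_meets :: "'a set set \<Rightarrow> 'a set set \<Rightarrow> 'a set set" where
  "pairwise_meets \<A> \<B> = {A \<inter> B | A B. A \<in> \<A> \<and> B \<in> \<B>}"

text \<open>The open sets of the new topology, as a bare set family. That they do form
  a topology is part of the theorem.\<close>

definition family_opens :: "'a set set \<Rightarrow> 'a topology \<Rightarrow> 'a set set" where
  "family_opens \<A> T = union_closure (pairwise_meets \<A> {U. openin T U})"

text \<open>The \<^const>\<open>topology\<close> coercion is meaningful only when its argument satisfies
  \<^const>\<open>istopology\<close>.\<close>

definition family_topology :: "'a set set \<Rightarrow> 'a topology \<Rightarrow> 'a topology" where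
  "family_topology \<A> T = topology (\<lambda>U. U \<in> family_opens \<A> T)"

text \<open>The first four conjuncts are the standing assumptions under which the notion
  of an \<open>S\<close>-disconnected family is introduced.\<close>

definition disconnected_family :: "'a topology \<Rightarrow> 'a set set \<Rightarrow> bool" where
  "disconnected_family S \<A> \<longleftrightarrow>
     finite \<A> \<and> pairwise disjnt \<A> \<and> {} \<notin> \<A> \<and> topspace S = \<Union>\<A> \<and>
     (\<forall>A\<in>\<A>. openin S A)"

end

theory Submission
  imports Defs
begin

text \<open>
  Since the pieces \<open>A \<in> \<A>\<close> are pairwise disjoint, a union of sets \<open>A \<inter> V\<close> with \<open>V\<close> open is
  controlled piece by piece: the traces on different pieces can be chosen independently, and
  each trace is an arbitrary relatively open set. So the new topology is the
  disjoint-sum topology of the subspaces \<open>A\<close>, realised on \<open>\<Union>\<A>\<close>: a set is open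
  precisely when all its traces are relatively open (\<open>in_family_opens_iff\<close>).

  Everything follows from this description. The axioms of a topology hold because trace
  commutes with intersections and unions. A single piece is open, and inside it nothing has
  changed. On \<open>\<Union>\<A>\<close> the new topology refines the subspace topology, which
  gives \<open>T\<^sub>0\<close>. Finally, connectedness of a piece depends only on its induced topology, so
  connected pieces stay connected; being an open partition into connected sets, they are
  the components (\<open>connected_components_of_open_partition\<close>).
\<close>

text \<open>Only a family member \<open>B = A\<close> can contribute to the trace on \<open>A\<close>, so a trace of a union
  of sets \<open>B \<inter> V\<close> is a union of sets \<open>A \<inter> V\<close>. Conversely, a set with relatively open traces is
  the union of these traces.\<close>

lemma in_family_opens_iff:
  assumes "pairwise disjnt \<A>"
  shows "U \<in> family_opens \<A> T \<longleftrightarrow>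
    U \<subseteq> \<Union>\<A> \<and> (\<forall>A\<in>\<A>. openin (subtopology T A) (U \<inter> A))"
proof
  assume "U \<in> family_opens \<A> T"
  then obtain \<S> where \<S>: "\<S> \<subseteq> pairwise_meets \<A> {V. openin T V}" and U: "U = \<Union>\<S>"
    by (auto simp: family_opens_def union_closure_def)
  have "openin (subtopology T A) (U \<inter> A)" if "A \<in> \<A>" for A
  proof -
    have "openin (subtopology T A) (S \<inter> A)" if "S \<in> \<S>" for S
    proof -
      obtain B V where B: "B \<in> \<A>" and V: "openin T V" and S: "S = B \<inter> V"
        using \<S> \<open>S \<in> \<S>\<close> by (auto simp: pairwise_meets_def)
      show ?thesis
      proof (cases "B = A")
        case True
        then have "S \<inter> A = V \<inter> A"
          using S by blast
        then show ?thesis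
          using V by (simp add: openin_subtopology_Int)
      next
        case False
        then have "S \<inter> A = {}"
          using assms B \<open>A \<in> \<A>\<close> S by (auto simp: pairwise_def disjnt_def)
        then show ?thesis
          by simp
      qed
    qed
    moreover have "U \<inter> A = \<Union>((\<lambda>S. S \<inter> A) ` \<S>)"
      using U by blast
    ultimately show ?thesis
      by (metis (no_types, lifting) imageE openin_Union)
  qed
  moreover have "U \<subseteq> \<Union>\<A>"
    using \<S> U by (auto simp: pairwise_meets_def)
  ultimately show "U \<subseteq> \<Union>\<A> \<and> (\<forall>A\<in>\<A>. openin (subtopology T A) (U \<inter> A))"
    by blast
next
  assume U: "U \<subseteq> \<Union>\<A> \<and> (\<forall>A\<in>\<A>. openin (subtopology T A) (U \<inter> A))"
  have "U \<inter> A \<in> pairwise_meets \<A> {V. openin T V}" if A: "A \<in> \<A>" for A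
  proof -
    obtain V where "openin T V" "U \<inter> A = V \<inter> A"
      using U A by (metis openin_subtopology)
    then show ?thesis
      using A by (auto simp: pairwise_meets_def Int_commute)
  qed
  then have "(\<lambda>A. U \<inter> A) ` \<A> \<subseteq> pairwise_meets \<A> {V. openin T V}"
    by (rule image_subsetI)
  moreover have "U = \<Union>((\<lambda>A. U \<inter> A) ` \<A>)"
    using U by blast
  ultimately show "U \<in> family_opens \<A> T"
    unfolding family_opens_def union_closure_def by blast
qed

lemma istopology_family_opens:
  assumes "pairwise disjnt \<A>"
  shows "istopology (\<lambda>U. U \<in> family_opens \<A> T)"
  unfolding istopology_def in_family_opens_iff [OF assms]
proof (intro conjI allI impI ballI)
  fix U V A
  assume "U \<subseteq> \<Union>\<A> \<and> (\<forall>A\<in>\<A>. openin (subtopology T A) (U \<inter> A))"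
    and "V \<subseteq> \<Union>\<A> \<and> (\<forall>A\<in>\<A>. openin (subtopology T A) (V \<inter> A))" and "A \<in> \<A>"
  then have "openin (subtopology T A) ((U \<inter> A) \<inter> (V \<inter> A))"
    by blast
  moreover have "(U \<inter> A) \<inter> (V \<inter> A) = U \<inter> V \<inter> A"
    by blast
  ultimately show "openin (subtopology T A) (U \<inter> V \<inter> A)"
    by simp
next
  fix \<K> A
  assume "\<forall>K\<in>\<K>. K \<subseteq> \<Union>\<A> \<and> (\<forall>A\<in>\<A>. openin (subtopology T A) (K \<inter> A))" and "A \<in> \<A>"
  then have "openin (subtopology T A) (\<Union>K\<in>\<K>. K \<inter> A)"
    by blast
  then show "openin (subtopology T A) (\<Union>\<K> \<inter> A)"
    by (simp only: Int_Union2)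
next
  fix U V
  assume "U \<subseteq> \<Union>\<A> \<and> (\<forall>A\<in>\<A>. openin (subtopology T A) (U \<inter> A))"
  then show "U \<inter> V \<subseteq> \<Union>\<A>"
    by (simp add: le_infI1)
next
  fix \<K>
  assume "\<forall>K\<in>\<K>. K \<subseteq> \<Union>\<A> \<and> (\<forall>A\<in>\<A>. openin (subtopology T A) (K \<inter> A))"
  then show "\<Union>\<K> \<subseteq> \<Union>\<A>"
    by (simp add: Sup_le_iff)
qed

lemma openin_family_topology_iff:
  assumes "pairwise disjnt \<A>"
  shows "openin (family_topology \<A> T) U \<longleftrightarrow>
    U \<subseteq> \<Union>\<A> \<and> (\<forall>A\<in>\<A>. openin (subtopology T A) (U \<inter> A))"
  unfolding family_topology_def topology_inverse' [OF istopology_family_opens [OF assms]]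
  by (rule in_family_opens_iff [OF assms])

lemma openin_family_topology_member:
  assumes "pairwise disjnt \<A>" "\<forall>A\<in>\<A>. A \<subseteq> topspace T" "A \<in> \<A>"
  shows "openin (family_topology \<A> T) A"
  unfolding openin_family_topology_iff [OF assms(1)]
proof (intro conjI ballI)
  fix B
  assume "B \<in> \<A>"
  then consider "B = A" | "A \<inter> B = {}"
    using assms by (auto simp: pairwise_def disjnt_def)
  then show "openin (subtopology T B) (A \<inter> B)"
    using assms(2,3) by cases (auto simp: openin_subtopology_refl)
qed (use assms(3) in blast)

lemma topspace_family_topology:
  assumes "pairwise disjnt \<A>" "\<forall>A\<in>\<A>. A \<subseteq> topspace T"
  shows "topspace (family_topology \<A> T) = \<Union>\<A>"
proof
  show "topspace (family_topology \<A> T) \<subseteq> \<Union>\<A>"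
    using openin_family_topology_iff [OF assms(1)] openin_topspace by blast
  show "\<Union>\<A> \<subseteq> topspace (family_topology \<A> T)"
    using openin_family_topology_member [OF assms] openin_subset by blast
qed

text \<open>The new topology is finer than the one \<open>T\<close> induces on \<open>\<Union>\<A>\<close>, and \<open>T\<^sub>0\<close> passes
  both to subspaces and to finer topologies on the same set.\<close>

lemma t0_space_family_topology:
  assumes "pairwise disjnt \<A>" "\<forall>A\<in>\<A>. A \<subseteq> topspace T" "t0_space T"
  shows "t0_space (family_topology \<A> T)"
proof (rule t0_space_expansive)
  show "t0_space (subtopology T (\<Union>\<A>))"
    using assms(3) by (rule t0_space_subtopology)
  show "topspace (family_topology \<A> T) = topspace (subtopology T (\<Union>\<A>))"
    using assms(2) by (auto simp: topspace_family_topology [OF assms(1,2)])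
next
  fix U
  assume "openin (subtopology T (\<Union>\<A>)) U"
  then obtain V where V: "openin T V" and U: "U = V \<inter> \<Union>\<A>"
    by (auto simp: openin_subtopology)
  have "U \<inter> A = V \<inter> A" if "A \<in> \<A>" for A
    using U that by blast
  then show "openin (family_topology \<A> T) U"
    using U V by (simp add: openin_family_topology_iff [OF assms(1)] openin_subtopology_Int)
qed

lemma subtopology_family_topology:
  assumes "pairwise disjnt \<A>" "\<forall>A\<in>\<A>. A \<subseteq> topspace T" "A \<in> \<A>"
  shows "subtopology (family_topology \<A> T) A = subtopology T A"
  unfolding topology_eq
proof (intro allI iffI)
  fix S
  assume "openin (subtopology (family_topology \<A> T) A) S"
  then show "openin (subtopology T A) S"
    using assms(3) by (auto simp: openin_subtopology [of "family_topology \<A> T"]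
        openin_family_topology_iff [OF assms(1)])
next
  fix S
  assume "openin (subtopology T A) S"
  then obtain V where V: "openin T V" and S: "S = V \<inter> A"
    by (auto simp: openin_subtopology)
  have "S \<in> family_opens \<A> T"
    \<comment> \<open>\<open>S\<close> is itself one of the generating sets \<open>A \<inter> V\<close>.\<close>
    unfolding family_opens_def union_closure_def pairwise_meets_def
    using V S assms(3) by (intro CollectI exI [of _ "{S}"]) auto
  then have "openin (family_topology \<A> T) S"
    by (simp add: family_topology_def istopology_family_opens [OF assms(1)])
  then show "openin (subtopology (family_topology \<A> T) A) S"
    using S by (simp add: subset_openin_subtopology)
qed

text \<open>Each block is also closed, its complement being the union of the other blocks. A connected
  set meeting a block therefore lies inside it, so connected blocks are maximal connected sets.\<close>

lemma connected_components_of_open_partition: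
  assumes "pairwise disjnt \<C>" "{} \<notin> \<C>" "\<Union>\<C> = topspace X"
    and op: "\<And>C. C \<in> \<C> \<Longrightarrow> openin X C"
    and conn: "\<And>C. C \<in> \<C> \<Longrightarrow> connectedin X C"
  shows "connected_components_of X = \<C>"
proof -
  have component: "connected_component_of_set X x = C" if C: "C \<in> \<C>" and x: "x \<in> C" for C x
  proof (rule connected_component_of_unique [OF x conn [OF C]])
    have "topspace X - C = \<Union>(\<C> - {C})"
      using assms(1) C unfolding assms(3) [symmetric] pairwise_def disjnt_def by blast
    then have "openin X (topspace X - C)"
      using op by (simp only:) (blast intro: openin_Union)
    then have "closedin X C"
      using op [OF C] openin_subset by (auto simp: closedin_def)
    then show "D \<subseteq> C" if "x \<in> D \<and> connectedin X D" for D
      using connectedin_clopen_cases [of X D C] op [OF C] that x by (auto simp: disjnt_def)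
  qed
  show ?thesis
  proof
    show "connected_components_of X \<subseteq> \<C>"
      using component by (auto simp: connected_components_of_def simp flip: assms(3))
    show "\<C> \<subseteq> connected_components_of X"
    proof
      fix C
      assume C: "C \<in> \<C>"
      then obtain x where "x \<in> C"
        using assms(2) by (metis ex_in_conv)
      then show "C \<in> connected_components_of X"
        using component [OF C] assms(3) C
        by (metis UnionI connected_component_in_connected_components_of)
    qed
  qed
qed

theorem theorem5p1:
  fixes T :: "'a topology" and \<A> :: "'a set set"
  assumes "finite \<A>"
    and "pairwise disjnt \<A>"
    and "{} \<notin> \<A>"
    and "\<forall>A\<in>\<A>. A \<subseteq> topspace T"
  shows "istopology (\<lambda>U. U \<in> family_opens \<A> T) \<and>
    topspace (family_topology \<A> T) = \<Union>\<A> \<and>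
    (t0_space T \<longrightarrow> t0_space (family_topology \<A> T)) \<and>
    (\<forall>A\<in>\<A>. subtopology T A = subtopology (family_topology \<A> T) A) \<and>
    disconnected_family (family_topology \<A> T) \<A> \<and>
    (\<Union>\<A> = topspace T \<and> (\<forall>A\<in>\<A>. connectedin T A) \<longrightarrow>
       connected_components_of (family_topology \<A> T) = \<A>)"
proof (intro conjI impI ballI)
  let ?S = "family_topology \<A> T"
  show "istopology (\<lambda>U. U \<in> family_opens \<A> T)"
    using assms(2) by (rule istopology_family_opens)
  show top: "topspace ?S = \<Union>\<A>"
    using assms(2,4) by (rule topspace_family_topology)
  show "t0_space ?S" if "t0_space T"
    using assms(2,4) that by (rule t0_space_family_topology)
  show sub: "subtopology T A = subtopology ?S A" if "A \<in> \<A>" for A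
    using subtopology_family_topology [OF assms(2,4) that] by simp
  have op: "openin ?S A" if "A \<in> \<A>" for A
    using assms(2,4) that by (rule openin_family_topology_member)
  then show "disconnected_family ?S \<A>"
    using assms(1-3) top by (simp add: disconnected_family_def)
  assume conn: "\<Union>\<A> = topspace T \<and> (\<forall>A\<in>\<A>. connectedin T A)"
  have "connectedin ?S A" if "A \<in> \<A>" for A
    \<comment> \<open>Connectedness of a set is a property of its induced topology.\<close>
    using conn that sub [OF that] by (metis connectedin_absolute)
  then show "connected_components_of ?S = \<A>"
    using assms(2,3) top op by (intro connected_components_of_open_partition) auto
qed

end
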